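(* Assume that an exponentially hard one-way permutation exists. Then there is a constant $c\ge 1$ such that no deterministic algorithm running in time $2^{O(k)}$ can solve the search task $\mathbf{Cert}(c)$ on all lengths $k\ge 1$.
   Context: TAUT is the set of propositional tautologies in the DeMorgan language. Formulas are encoded by binary strings, so a formula of size $k$ is an element of $\{0,1\}^k$. $1^{(k)}$ is the string of $k$ ones. **Exponentially hard one-way permutation.** A polynomial-time computable permutation $h:\{0,1\}^*\to\{0,1\}^*$ (permuting each $\{0,1\}^\ell$) is $\epsilon(\ell)$ one-way with security parameter $t(\ell)$ if for all $\ell$ and every Boolean circuit $D$ with $\ell$ inputs and size at most $t(\ell)$, $\mathrm{Prob}_{v\in\{0,1\}^\ell}[D(h(v))=v]\le\epsilon(\ell)$. It is exponentially hard if it is $2^{-\ell^{\Omega(1)}}$ one-way with security parameter $2^{\ell^{\Omega(1)}}$ (that is, for some constant $\gamma>0$ this holds with $\epsilon(\ell)=2^{-\ell^\gamma}$ and $t(\ell)=2^{\ell^\gamma}$ for all sufficiently large $\ell$). **Search task $\mathbf{Cert}(c)$**, for a constant $c\ge1$: - Input: $1^{(k)}$ and a size $k^{c^2}$ Boolean circuit $D(x,y)$ in $k$ variables $x=(x_1,\dots,x_k)$ and $k^c$ variables $y=(y_1,\dots,y_{k^c})$. - Required output: either a size $k$ falsifiable formula $\varphi$ such that $D(\varphi,y)$ is satisfiable (as a circuit in $y$), or a size $k$ tautology $\tau$ such that $D(\tau,y)$ is unsatisfiable. An algorithm solves $\mathbf{Cert}(c)$ on length $k$ if for every input with parameter $k$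 it produces a valid output (in particular it does not solve the task on length $k$ if some such input has no valid output). *)

theory Defs
  imports "HOL-Probability.Probability" "HOL-Computational_Algebra.Polynomial"
begin

definition bitstrings :: "nat \<Rightarrow> bool list set" where
  "bitstrings l = {w. length w = l}"


section \<open>Self-delimiting binary codes\<close>

text \<open>Binary digits of \<^term>\<open>n\<close>, least significant first, each preceded by a 1; the code ends with a 0.\<close>

fun nat_code :: "nat \<Rightarrow> bool list" where
  "nat_code n = (if n = 0 then [False] else True # odd n # nat_code (n div 2))"

declare nat_code.simps [simp del]

definition list_code :: "('a \<Rightarrow> bool list) \<Rightarrow> 'a list \<Rightarrow> bool list" where
  "list_code f xs = concat (map (\<lambda>x. True # f x) xs) @ [False]"


section \<open>Propositional formulas in the DeMorgan language\<close>

datatype form = Bot | Top | Var nat | Neg form | Conj form form | Disj form form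

primrec holds :: "(nat \<Rightarrow> bool) \<Rightarrow> form \<Rightarrow> bool" where
  "holds v Bot = False"
| "holds v Top = True"
| "holds v (Var n) = v n"
| "holds v (Neg p) = (\<not> holds v p)"
| "holds v (Conj p q) = (holds v p \<and> holds v q)"
| "holds v (Disj p q) = (holds v p \<or> holds v q)"

definition tautology :: "form \<Rightarrow> bool" where
  "tautology p \<longleftrightarrow> (\<forall>v. holds v p)"

definition falsifiable :: "form \<Rightarrow> bool" where
  "falsifiable p \<longleftrightarrow> (\<exists>v. \<not> holds v p)"

text \<open>Prefix (Polish) notation over a prefix-free binary code of the symbols.\<close>

primrec form_code :: "form \<Rightarrow> bool list" where
  "form_code Bot = [False, False]"
| "form_code Top = [True, False]"
| "form_code (Var n) = [True, True, True] @ nat_code n"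
| "form_code (Neg p) = [True, True, False] @ form_code p"
| "form_code (Conj p q) = [False, True, False] @ form_code p @ form_code q"
| "form_code (Disj p q) = [False, True, True] @ form_code p @ form_code q"

text \<open>
  Codes are taken up to trailing zeros, so that a formula of smaller size can be padded to any
  larger size and every length \<open>k \<ge> 1\<close> has both tautologies and falsifiable formulas.
  A formula of size \<open>k\<close> is thus a string of length \<open>k\<close> that encodes some formula.
\<close>

definition encodes :: "bool list \<Rightarrow> form \<Rightarrow> bool" where
  "encodes w p \<longleftrightarrow> (\<exists>m n. w @ replicate m False = form_code p @ replicate n False)"

lemma nat_code_prefix_free:
  "nat_code m @ r = nat_code n @ s \<Longrightarrow> m = n \<and> r = s"
proof (induction m arbitrary: n rule: less_induct)
  case (less m)
  show ?case
  proof (cases "m = 0 \<or> n = 0")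
    case True
    then show ?thesis
      using less.prems by (auto simp: nat_code.simps[of m] nat_code.simps[of n] split: if_splits)
  next
    case False
    then have par: "odd m = odd n" and eq: "nat_code (m div 2) @ r = nat_code (n div 2) @ s"
      using less.prems by (simp_all add: nat_code.simps[of m] nat_code.simps[of n])
    have *: "m div 2 = n div 2 \<and> r = s"
      using less.IH[OF _ eq] False by simp
    then have "m div 2 = n div 2" ..
    with par have "m = n"
      by presburger
    with * show ?thesis
      by simp
  qed
qed

lemma form_code_prefix_free:
  "form_code p @ r = form_code q @ s \<Longrightarrow> p = q \<and> r = s"
proof (induction p arbitrary: q r s)
  case (Var n)
  then show ?case by (cases q) (auto dest: nat_code_prefix_free)
next
  case (Neg p)
  from Neg.prems Neg.IH show ?case by (cases q) simp_all
next
  case (Conj p1 p2)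
  show ?case
  proof (cases q)
    case q: (Conj q1 q2)
    with Conj.prems have "form_code p1 @ form_code p2 @ r = form_code q1 @ form_code q2 @ s"
      by simp
    with Conj.IH q show ?thesis by metis
  qed (use Conj.prems in simp_all)
next
  case (Disj p1 p2)
  show ?case
  proof (cases q)
    case q: (Disj q1 q2)
    with Disj.prems have "form_code p1 @ form_code p2 @ r = form_code q1 @ form_code q2 @ s"
      by simp
    with Disj.IH q show ?thesis by metis
  qed (use Disj.prems in simp_all)
next
  case Bot
  then show ?case by (cases q) simp_all
next
  case Top
  then show ?case by (cases q) simp_all
qed

lemma encodes_unique:
  assumes "encodes w p" and "encodes w q"
  shows "p = q"
proof -
  obtain m n m' n' where
    "w @ replicate m False = form_code p @ replicate n False"
    "w @ replicate m' False = form_code q @ replicate n' False"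
    using assms by (auto simp: encodes_def)
  then have "form_code p @ replicate (n + m') False = form_code q @ replicate (n' + m) False"
    by (metis (no_types, opaque_lifting) add.commute append.assoc replicate_add)
  then show ?thesis by (blast dest: form_code_prefix_free)
qed

lemma encodes_Bot: "encodes (replicate k False) Bot"
  unfolding encodes_def
  by (intro exI[of _ 2] exI[of _ k]) (simp add: replicate_app_Cons_same eval_nat_numeral)

lemma encodes_Top: "encodes (True # replicate k False) Top"
  unfolding encodes_def
  by (intro exI[of _ 1] exI[of _ k]) (simp add: replicate_app_Cons_same)


section \<open>Boolean circuits\<close>

text \<open>
  A circuit with \<open>n\<close> inputs is a straight-line program over the DeMorgan basis with fan-in at
  most two, together with the list of its output wires. Wires \<open>0, \<dots>, n - 1\<close> are the inputs and
  wire \<open>n + i\<close> is the value of gate number \<open>i\<close>. Its size is the number of gates; inputs are not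
  counted.
\<close>

datatype gate = ConstGate bool | NotGate nat | AndGate nat nat | OrGate nat nat

datatype circuit = Circuit (gates: "gate list") (outputs: "nat list")

primrec gate_args :: "gate \<Rightarrow> nat set" where
  "gate_args (ConstGate b) = {}"
| "gate_args (NotGate i) = {i}"
| "gate_args (AndGate i j) = {i, j}"
| "gate_args (OrGate i j) = {i, j}"

primrec gate_value :: "bool list \<Rightarrow> gate \<Rightarrow> bool" where
  "gate_value vs (ConstGate b) = b"
| "gate_value vs (NotGate i) = (\<not> vs ! i)"
| "gate_value vs (AndGate i j) = (vs ! i \<and> vs ! j)"
| "gate_value vs (OrGate i j) = (vs ! i \<or> vs ! j)"

definition circuit_eval :: "circuit \<Rightarrow> bool list \<Rightarrow> bool list" where
  "circuit_eval C inp =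
     (let vs = foldl (\<lambda>vs g. vs @ [gate_value vs g]) inp (gates C)
      in map (\<lambda>i. vs ! i) (outputs C))"

definition circuit_size :: "circuit \<Rightarrow> nat" where
  "circuit_size C = length (gates C)"

definition wf_circuit :: "nat \<Rightarrow> nat \<Rightarrow> circuit \<Rightarrow> bool" where
  "wf_circuit n m C \<longleftrightarrow>
     (\<forall>i < length (gates C). \<forall>j \<in> gate_args (gates C ! i). j < n + i) \<and>
     (\<forall>j \<in> set (outputs C). j < n + length (gates C)) \<and>
     length (outputs C) = m"

primrec gate_code :: "gate \<Rightarrow> bool list" where
  "gate_code (ConstGate b) = [False, False, b]"
| "gate_code (NotGate i) = [False, True] @ nat_code i"
| "gate_code (AndGate i j) = [True, False] @ nat_code i @ nat_code j"
| "gate_code (OrGate i j) = [True, True] @ nat_code i @ nat_code j"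

definition circuit_code :: "circuit \<Rightarrow> bool list" where
  "circuit_code C = list_code gate_code (gates C) @ list_code nat_code (outputs C)"


section \<open>Deterministic Turing machines\<close>

text \<open>
  One tape, infinite to the right. States are \<open>{0..<states M}\<close>, with 0 initial and 1 halting;
  tape symbols are \<open>{0..<symbols M}\<close>, where 0 is the blank and 1, 2 stand for the bits 0, 1.
  Only the restriction of \<open>delta\<close> to these finite sets matters.
  The classes of functions computable in polynomial time and in time \<open>2\<^bsup>O(k)\<^esup>\<close> are the same as for
  multi-tape machines.
\<close>

datatype move = MoveL | MoveR | Stay

record tm =
  states :: nat
  symbols :: nat
  delta :: "nat \<Rightarrow> nat \<Rightarrow> nat \<times> nat \<times> move"

definition wf_tm :: "tm \<Rightarrow> bool" where
  "wf_tm M \<longleftrightarrow> 2 \<le> states M \<and> 3 \<le> symbols M \<and>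
     (\<forall>q < states M. \<forall>a < symbols M.
        case delta M q a of (q', a', d) \<Rightarrow> q' < states M \<and> a' < symbols M)"

text \<open>A configuration consists of the state, the head position and the tape contents.\<close>

type_synonym config = "nat \<times> nat \<times> (nat \<Rightarrow> nat)"

definition bit_symbol :: "bool \<Rightarrow> nat" where
  "bit_symbol b = (if b then 2 else 1)"

definition tape_of :: "bool list \<Rightarrow> nat \<Rightarrow> nat" where
  "tape_of w i = (if i < length w then bit_symbol (w ! i) else 0)"

definition init_config :: "bool list \<Rightarrow> config" where
  "init_config w = (0, 0, tape_of w)"

text \<open>A left move at cell 0 leaves the head there (truncated subtraction).\<close>

primrec move_head :: "move \<Rightarrow> nat \<Rightarrow> nat" where
  "move_head MoveL h = h - 1"
| "move_head MoveR h = h + 1"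
| "move_head Stay h = h"

definition step :: "tm \<Rightarrow> config \<Rightarrow> config" where
  "step M cf = (case cf of (q, h, t) \<Rightarrow>
     if q = 1 then cf
     else (case delta M q (t h) of (q', a', d) \<Rightarrow> (q', move_head d h, t(h := a'))))"

definition halts_within :: "tm \<Rightarrow> bool list \<Rightarrow> nat \<Rightarrow> bool" where
  "halts_within M w n \<longleftrightarrow> fst ((step M ^^ n) (init_config w)) = 1"

text \<open>The output is the bit string written on the tape from cell 0 up to the first blank.\<close>

definition returns :: "tm \<Rightarrow> bool list \<Rightarrow> bool list \<Rightarrow> bool" where
  "returns M w out \<longleftrightarrow>
     (\<exists>n h t. (step M ^^ n) (init_config w) = (1, h, t) \<and>
        (\<forall>i \<le> length out. t i = tape_of out i))"

definition poly_time_computable :: "(bool list \<Rightarrow> bool list) \<Rightarrow> bool" where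
  "poly_time_computable f \<longleftrightarrow>
     (\<exists>M (p :: nat poly). wf_tm M \<and>
        (\<forall>w. halts_within M w (poly p (length w)) \<and> returns M w (f w)))"


section \<open>One-way permutations\<close>

definition one_way_at :: "(bool list \<Rightarrow> bool list) \<Rightarrow> (nat \<Rightarrow> real) \<Rightarrow> (nat \<Rightarrow> real) \<Rightarrow> nat \<Rightarrow> bool" where
  "one_way_at h \<epsilon> t l \<longleftrightarrow>
     (\<forall>D. wf_circuit l l D \<and> real (circuit_size D) \<le> t l \<longrightarrow>
        measure_pmf.prob (pmf_of_set (bitstrings l)) {v. circuit_eval D (h v) = v} \<le> \<epsilon> l)"

definition exp_hard_one_way_permutation :: "(bool list \<Rightarrow> bool list) \<Rightarrow> bool" where
  "exp_hard_one_way_permutation h \<longleftrightarrow>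
     poly_time_computable h \<and>
     (\<forall>l. bij_betw h (bitstrings l) (bitstrings l)) \<and>
     (\<exists>\<gamma>::real. \<gamma> > 0 \<and>
        (\<forall>\<^sub>F l in sequentially.
           one_way_at h (\<lambda>l. 2 powr (- (real l powr \<gamma>))) (\<lambda>l. 2 powr (real l powr \<gamma>)) l))"


section \<open>The search task Cert\<close>

text \<open>
  Circuits in the \<open>k + k ^ c\<close> variables \<open>x, y\<close>, in this order. Any smaller circuit can be extended
  to size exactly \<open>k ^ c\<^sup>2\<close> by unused gates.
\<close>

definition cert_circuit :: "nat \<Rightarrow> nat \<Rightarrow> circuit \<Rightarrow> bool" where
  "cert_circuit c k D \<longleftrightarrow> wf_circuit (k + k ^ c) 1 D \<and> circuit_size D = k ^ (c\<^sup>2)"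

definition cert_input :: "nat \<Rightarrow> circuit \<Rightarrow> bool list" where
  "cert_input k D = replicate k True @ [False] @ circuit_code D"

definition satisfiable_in_y :: "nat \<Rightarrow> circuit \<Rightarrow> bool list \<Rightarrow> bool" where
  "satisfiable_in_y m D x \<longleftrightarrow> (\<exists>y \<in> bitstrings m. circuit_eval D (x @ y) = [True])"

definition cert_valid :: "nat \<Rightarrow> nat \<Rightarrow> circuit \<Rightarrow> bool list \<Rightarrow> bool" where
  "cert_valid c k D w \<longleftrightarrow> w \<in> bitstrings k \<and>
     (\<exists>p. encodes w p \<and>
        (falsifiable p \<and> satisfiable_in_y (k ^ c) D w \<or>
         tautology p \<and> \<not> satisfiable_in_y (k ^ c) D w))"

definition solves_cert :: "nat \<Rightarrow> tm \<Rightarrow> nat \<Rightarrow> bool" where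
  "solves_cert c M k \<longleftrightarrow>
     (\<forall>D. cert_circuit c k D \<longrightarrow> (\<exists>w. returns M (cert_input k D) w \<and> cert_valid c k D w))"

text \<open>
  Running time \<open>2\<^bsup>O(k)\<^esup>\<close> in the parameter \<open>k\<close>; for \<open>k \<ge> 1\<close>, multiplicative constants are absorbed
  into \<open>a\<close>.
\<close>

definition cert_exp_time :: "nat \<Rightarrow> tm \<Rightarrow> bool" where
  "cert_exp_time c M \<longleftrightarrow>
     (\<exists>a::nat. \<forall>k \<ge> 1. \<forall>D. cert_circuit c k D \<longrightarrow> halts_within M (cert_input k D) (2 ^ (a * k)))"

end

theory Submission
  imports Defs
begin

text \<open>
  Let \<open>h\<close> be the one-way permutation and \<open>l = k ^ c\<close>. For \<open>b\<close> of length \<open>l\<close> and \<open>j < l\<close> consider the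
  circuit \<open>D(x, y)\<close> which ignores \<open>x\<close> and checks that \<open>h y = b\<close> and \<open>y ! j\<close>. If bit \<open>j\<close> of the
  preimage of \<open>b\<close> is 1, then \<open>D\<close> accepts every \<open>x\<close> and a solution of the task is a falsifiable
  formula; otherwise \<open>D\<close> accepts no \<open>x\<close> and a solution is a tautology. Tautologies of size \<open>k\<close> are
  recognised by a table with at most \<open>2 ^ k\<close> entries, so an algorithm for the task that runs in time
  \<open>2\<^bsup>O(k)\<^esup>\<close> inverts \<open>h\<close> on all of \<open>{0,1}\<^bsup>l\<^esup>\<close> by circuits of size \<open>2\<^bsup>O(k)\<^esup>\<close>. If \<open>c\<close> is large, this
  is below \<open>2 powr (l powr \<gamma>)\<close>.
\<close>

section \<open>Families of Boolean functions computed by few gates\<close>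

text \<open>Straight-line programs without wire numbers: \<open>B\<close> holds the functions
  available for free, \<open>s\<close> counts gates, and \<open>F\<close> collects the functions on
  all wires. As \<open>F\<close> only grows, a value once computed can be reused at no cost.\<close>

inductive generates :: "('v \<Rightarrow> bool) set \<Rightarrow> nat \<Rightarrow> ('v \<Rightarrow> bool) set \<Rightarrow> bool" for B where
  base: "generates B 0 B"
| const: "generates B s F \<Longrightarrow> generates B (Suc s) (insert (\<lambda>_. b) F)"
| neg: "generates B s F \<Longrightarrow> f \<in> F \<Longrightarrow> generates B (Suc s) (insert (\<lambda>v. \<not> f v) F)"
| conj: "generates B s F \<Longrightarrow> f \<in> F \<Longrightarrow> g \<in> F \<Longrightarrow>
    generates B (Suc s) (insert (\<lambda>v. f v \<and> g v) F)"
| disj: "generates B s F \<Longrightarrow> f \<in> F \<Longrightarrow> g \<in> F \<Longrightarrow>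
    generates B (Suc s) (insert (\<lambda>v. f v \<or> g v) F)"

text \<open>The slack in \<open>s\<close> and the inclusion \<open>G \<subseteq> F\<close> allow
  rounding up counts and forgetting intermediate wires.\<close>

definition computes :: "('v \<Rightarrow> bool) set \<Rightarrow> nat \<Rightarrow> ('v \<Rightarrow> bool) set \<Rightarrow> bool" where
  "computes B s G \<longleftrightarrow> (\<exists>r\<le>s. \<exists>F. generates B r F \<and> G \<subseteq> F)"

lemma generates_base_subset: "generates B s F \<Longrightarrow> B \<subseteq> F"
  by (induction rule: generates.induct) auto

text \<open>The gates that build \<open>H\<close> from \<open>G\<close> can be replayed on top of
  \<open>F\<close>, because every function of \<open>G\<close> is already a wire there.\<close>

lemma generates_trans:
  assumes "generates B s F" and "G \<subseteq> F" and "generates G t H"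
  shows "generates B (s + t) (F \<union> H)"
  using assms(3)
proof (induction rule: generates.induct)
  case base
  then show ?case using assms(1,2) by (simp add: Un_absorb2)
qed (auto intro: generates.intros)

section \<open>Rules for gate counts\<close>

lemma computes_refl: "G \<subseteq> B \<Longrightarrow> computes B s G"
  unfolding computes_def by (intro exI[of _ 0] exI[of _ B] conjI) (simp_all add: generates.base)

lemma computes_mono: "computes B s G \<Longrightarrow> s \<le> t \<Longrightarrow> H \<subseteq> G \<Longrightarrow> computes B t H"
  unfolding computes_def using le_trans[of _ s t] by fast

text \<open>Costs add instead of multiplying, since \<open>G\<close> is computed once and shared by
  all of \<open>H\<close>.\<close>

lemma computes_trans:
  assumes "computes B s G" and "computes G t H"
  shows "computes B (s + t) H"
proof -
  obtain r F r' F' where "r \<le> s" "generates B r F" "G \<subseteq> F" "r' \<le> t" "generates G r' F'" "H \<subseteq> F'"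
    using assms by (auto simp: computes_def)
  then have "generates B (r + r') (F \<union> F')" "r + r' \<le> s + t" "H \<subseteq> F \<union> F'"
    by (auto intro: generates_trans)
  then show ?thesis unfolding computes_def by blast
qed

lemma computes_Un:
  assumes "computes B s G" and "computes B t H"
  shows "computes B (s + t) (G \<union> H)"
proof -
  obtain r F r' F' where *: "r \<le> s" "generates B r F" "G \<subseteq> F" "r' \<le> t" "generates B r' F'" "H \<subseteq> F'"
    using assms by (auto simp: computes_def)
  then have "generates B (r + r') (F \<union> F')" "r + r' \<le> s + t" "G \<union> H \<subseteq> F \<union> F'"
    using generates_trans[OF *(2) generates_base_subset[OF *(2)] *(5)] by auto
  then show ?thesis unfolding computes_def by blast
qed

lemma computes_image:
  assumes "finite I" and "\<And>i. i \<in> I \<Longrightarrow> computes B s {f i}"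
  shows "computes B (card I * s) (f ` I)"
  using assms
proof (induction rule: finite_induct)
  case empty
  then show ?case by (simp add: computes_refl)
next
  case (insert i I)
  then have "computes B (s + card I * s) ({f i} \<union> f ` I)"
    by (intro computes_Un) auto
  with insert.hyps show ?case by simp
qed

lemma computes_const: "computes B 1 {\<lambda>_. b}"
  unfolding computes_def
  by (intro exI[of _ 1] exI[of _ "insert (\<lambda>_. b) B"] conjI)
    (simp_all add: generates.const[OF generates.base])

lemma computes_neg:
  assumes "computes B s {f}"
  shows "computes B (Suc s) {\<lambda>v. \<not> f v}"
proof -
  obtain r F where "r \<le> s" "generates B r F" "f \<in> F"
    using assms by (auto simp: computes_def)
  then show ?thesis
    unfolding computes_def using generates.neg by (intro exI[of _ "Suc r"]) blast
qed

lemma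
  assumes "computes B s {f}" and "computes B t {g}"
  shows computes_conj: "computes B (Suc (s + t)) {\<lambda>v. f v \<and> g v}"
    and computes_disj: "computes B (Suc (s + t)) {\<lambda>v. f v \<or> g v}"
proof -
  obtain r F where *: "r \<le> s + t" "generates B r F" "f \<in> F" "g \<in> F"
    using computes_Un[OF assms] by (auto simp: computes_def)
  then show "computes B (Suc (s + t)) {\<lambda>v. f v \<and> g v}"
    unfolding computes_def using generates.conj by (intro exI[of _ "Suc r"]) blast
  show "computes B (Suc (s + t)) {\<lambda>v. f v \<or> g v}"
    unfolding computes_def using * generates.disj by (intro exI[of _ "Suc r"]) blast
qed

text \<open>A chain of binary disjunctions that starts from the constant \<open>False\<close>:
  \<open>Suc s\<close> pays for one member and its gate, the final 1 for the constant.\<close>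

lemma computes_Bex:
  assumes "finite I" and "\<And>i. i \<in> I \<Longrightarrow> computes B s {f i}"
  shows "computes B (card I * Suc s + 1) {\<lambda>v. \<exists>i\<in>I. f i v}"
  using assms
proof (induction rule: finite_induct)
  case empty
  then show ?case using computes_const[of B False] by simp
next
  case (insert i I)
  then have "computes B (Suc (s + (card I * Suc s + 1))) {\<lambda>v. f i v \<or> (\<exists>i\<in>I. f i v)}"
    by (intro computes_disj) auto
  with insert.hyps show ?case by (simp add: algebra_simps)
qed

lemma computes_Ball:
  assumes "finite I" and "\<And>i. i \<in> I \<Longrightarrow> computes B s {f i}"
  shows "computes B (card I * Suc s + 1) {\<lambda>v. \<forall>i\<in>I. f i v}"
  using assms
proof (induction rule: finite_induct)
  case empty
  then show ?case using computes_const[of B True] by simp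
next
  case (insert i I)
  then have "computes B (Suc (s + (card I * Suc s + 1))) {\<lambda>v. f i v \<and> (\<forall>i\<in>I. f i v)}"
    by (intro computes_conj) auto
  with insert.hyps show ?case by (simp add: algebra_simps)
qed

text \<open>\<open>f\<close> and \<open>g\<close> are charged once in each disjunct, which gives the
  factors 2; the 5 gates are one disjunction, two conjunctions and two negations.\<close>

lemma computes_iff:
  assumes "computes B s {f}" and "computes B t {g}"
  shows "computes B (2 * s + 2 * t + 5) {\<lambda>v. f v = g v}"
proof -
  have *: "(f v = g v) = ((f v \<and> g v) \<or> (\<not> f v \<and> \<not> g v))" for v
    by blast
  have "computes B (Suc (Suc (s + t) + Suc (Suc s + Suc t))) {\<lambda>v. f v = g v}"
    unfolding *
    by (rule computes_disj computes_conj computes_neg assms)+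
  then show ?thesis by (rule computes_mono) simp_all
qed


section \<open>Circuits\<close>

text \<open>Inputs are valuations here, so that equality of functions does not depend on an input length.\<close>

definition inputs :: "nat \<Rightarrow> ((nat \<Rightarrow> bool) \<Rightarrow> bool) set" where
  "inputs n = (\<lambda>i v. v i) ` {..<n}"

lemma in_inputs: "i < n \<Longrightarrow> (\<lambda>v. v i) \<in> inputs n"
  by (auto simp: inputs_def)

section \<open>Straight-line programs as gate lists\<close>

definition wires :: "bool list \<Rightarrow> gate list \<Rightarrow> bool list" where
  "wires xs gs = foldl (\<lambda>vs g. vs @ [gate_value vs g]) xs gs"

definition wf_gates :: "nat \<Rightarrow> gate list \<Rightarrow> bool" where
  "wf_gates n gs \<longleftrightarrow> (\<forall>i < length gs. \<forall>j \<in> gate_args (gs ! i). j < n + i)"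

lemma wires_snoc: "wires xs (gs @ [g]) = wires xs gs @ [gate_value (wires xs gs) g]"
  by (simp add: wires_def)

lemma wires_append: "wires xs (gs @ gs') = wires (wires xs gs) gs'"
  by (simp add: wires_def)

lemma length_wires: "length (wires xs gs) = length xs + length gs"
  by (induction gs rule: rev_induct) (simp add: wires_def, simp add: wires_snoc)

lemma wires_nth: "j < length xs \<Longrightarrow> wires xs gs ! j = xs ! j"
  by (induction gs rule: rev_induct)
    (simp add: wires_def, simp add: wires_snoc nth_append length_wires)

lemma wires_ConstGate: "wires xs (map ConstGate bs) = xs @ bs"
  by (induction bs rule: rev_induct) (simp add: wires_def, simp add: wires_snoc)

lemma wf_gates_snoc: "wf_gates n gs \<Longrightarrow> \<forall>j \<in> gate_args g. j < n + length gs \<Longrightarrow> wf_gates n (gs @ [g])"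
  unfolding wf_gates_def by (auto simp: nth_append less_Suc_eq)

text \<open>Each rule of \<open>generates\<close> appends one gate, whose value sits on wire
  \<open>n + s\<close>; earlier wires keep their numbers, so the wires found for the old functions
  stay correct.\<close>

lemma generates_gates:
  assumes "generates (inputs n) s F"
  shows "\<exists>gs. length gs = s \<and> wf_gates n gs \<and>
    (\<forall>f\<in>F. \<exists>j < n + s. \<forall>xs. length xs = n \<longrightarrow> wires xs gs ! j = f ((!) xs))"
    (is "?P s F")
proof -
  have extend: "?P (Suc s) (insert f F)"
    if gs: "length gs = s" "wf_gates n gs"
      "\<forall>f\<in>F. \<exists>j < n + s. \<forall>xs. length xs = n \<longrightarrow> wires xs gs ! j = f ((!) xs)"
    and g: "\<forall>j \<in> gate_args g. j < n + s"
      "\<And>xs. length xs = n \<Longrightarrow> gate_value (wires xs gs) g = f ((!) xs)"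
    for gs g f F s
  proof (intro exI[of _ "gs @ [g]"] conjI ballI)
    show "wf_gates n (gs @ [g])" using gs g by (intro wf_gates_snoc) auto
    fix f' assume f': "f' \<in> insert f F"
    show "\<exists>j < n + Suc s. \<forall>xs. length xs = n \<longrightarrow> wires xs (gs @ [g]) ! j = f' ((!) xs)"
    proof (cases "f' = f")
      case True
      then show ?thesis using gs g
        by (intro exI[of _ "n + s"]) (simp add: wires_snoc nth_append length_wires)
    next
      case False
      then obtain j where "j < n + s" "\<forall>xs. length xs = n \<longrightarrow> wires xs gs ! j = f' ((!) xs)"
        using f' gs by auto
      then show ?thesis using gs
        by (intro exI[of _ j]) (simp add: wires_snoc nth_append length_wires)
    qed
  qed (use gs in simp)
  show ?thesis
    using assms
  proof (induction rule: generates.induct)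
    case base
    show ?case
      by (intro exI[of _ "[]"]) (auto simp: wf_gates_def wires_def inputs_def)
  next
    case (const s F b)
    then obtain gs where "length gs = s" "wf_gates n gs"
      "\<forall>f\<in>F. \<exists>j < n + s. \<forall>xs. length xs = n \<longrightarrow> wires xs gs ! j = f ((!) xs)" by auto
    then show ?case by (rule extend[where g = "ConstGate b"]) auto
  next
    case (neg s F f)
    then obtain gs where gs: "length gs = s" "wf_gates n gs"
      "\<forall>f\<in>F. \<exists>j < n + s. \<forall>xs. length xs = n \<longrightarrow> wires xs gs ! j = f ((!) xs)" by auto
    then obtain i where "i < n + s" "\<forall>xs. length xs = n \<longrightarrow> wires xs gs ! i = f ((!) xs)"
      using neg.hyps by blast
    with gs show ?case by (intro extend[where g = "NotGate i"]) auto
  next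
    case (conj s F f f')
    then obtain gs where gs: "length gs = s" "wf_gates n gs"
      "\<forall>f\<in>F. \<exists>j < n + s. \<forall>xs. length xs = n \<longrightarrow> wires xs gs ! j = f ((!) xs)" by auto
    obtain i where i: "i < n + s" "\<forall>xs. length xs = n \<longrightarrow> wires xs gs ! i = f ((!) xs)"
      using gs(3) conj.hyps(2) by blast
    obtain j where j: "j < n + s" "\<forall>xs. length xs = n \<longrightarrow> wires xs gs ! j = f' ((!) xs)"
      using gs(3) conj.hyps(3) by blast
    from gs i j show ?case by (intro extend[where g = "AndGate i j"]) auto
  next
    case (disj s F f f')
    then obtain gs where gs: "length gs = s" "wf_gates n gs"
      "\<forall>f\<in>F. \<exists>j < n + s. \<forall>xs. length xs = n \<longrightarrow> wires xs gs ! j = f ((!) xs)" by auto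
    obtain i where i: "i < n + s" "\<forall>xs. length xs = n \<longrightarrow> wires xs gs ! i = f ((!) xs)"
      using gs(3) disj.hyps(2) by blast
    obtain j where j: "j < n + s" "\<forall>xs. length xs = n \<longrightarrow> wires xs gs ! j = f' ((!) xs)"
      using gs(3) disj.hyps(3) by blast
    from gs i j show ?case by (intro extend[where g = "OrGate i j"]) auto
  qed
qed

lemma computes_gates:
  assumes "computes (inputs n) s G"
  obtains gs where "length gs \<le> s" "wf_gates n gs"
    "\<forall>f\<in>G. \<exists>j < n + length gs. \<forall>xs. length xs = n \<longrightarrow> wires xs gs ! j = f ((!) xs)"
proof -
  obtain r F where "r \<le> s" "generates (inputs n) r F" "G \<subseteq> F"
    using assms by (auto simp: computes_def)
  moreover from generates_gates[OF this(2)] obtain gs where "length gs = r" "wf_gates n gs"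
    "\<forall>f\<in>F. \<exists>j < n + r. \<forall>xs. length xs = n \<longrightarrow> wires xs gs ! j = f ((!) xs)" by blast
  ultimately show thesis by (intro that[of gs]) blast+
qed

lemma computes_circuit:
  assumes "computes (inputs n) s (f ` {..<m})"
  obtains C where "wf_circuit n m C" "circuit_size C \<le> s"
    "\<And>xs. length xs = n \<Longrightarrow> circuit_eval C xs = map (\<lambda>i. f i ((!) xs)) [0..<m]"
proof -
  obtain gs where gs: "length gs \<le> s" "wf_gates n gs"
    "\<forall>f\<in>f ` {..<m}. \<exists>j < n + length gs. \<forall>xs. length xs = n \<longrightarrow> wires xs gs ! j = f ((!) xs)"
    using computes_gates[OF assms] .
  then have "\<forall>i<m. \<exists>j < n + length gs. \<forall>xs. length xs = n \<longrightarrow> wires xs gs ! j = f i ((!) xs)"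
    by auto
  then obtain out where out: "\<And>i. i < m \<Longrightarrow> out i < n + length gs"
    "\<And>i xs. i < m \<Longrightarrow> length xs = n \<Longrightarrow> wires xs gs ! out i = f i ((!) xs)"
    by metis
  show thesis
  proof (rule that[of "Circuit gs (map out [0..<m])"])
    show "wf_circuit n m (Circuit gs (map out [0..<m]))"
      using gs out unfolding wf_circuit_def wf_gates_def by auto
    show "circuit_size (Circuit gs (map out [0..<m])) \<le> s"
      using gs by (simp add: circuit_size_def)
    show "circuit_eval (Circuit gs (map out [0..<m])) xs = map (\<lambda>i. f i ((!) xs)) [0..<m]"
      if "length xs = n" for xs
      using out that by (simp add: circuit_eval_def Let_def flip: wires_def)
  qed
qed

text \<open>
  Replacing the last \<open>l\<close> inputs by constant gates keeps the numbering of all wires, so the hardwired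
  bits occur in the circuit only as the arguments of its first \<open>l\<close> gates.
\<close>

lemma computes_hardwired_circuit:
  assumes "computes (inputs (n + l)) s {f}" and "l + s \<le> S"
  obtains gs out where
    "\<And>b. length b = l \<Longrightarrow> wf_circuit n 1 (Circuit (map ConstGate b @ gs) [out])"
    "\<And>b. length b = l \<Longrightarrow> circuit_size (Circuit (map ConstGate b @ gs) [out]) = S"
    "\<And>b xs. length b = l \<Longrightarrow> length xs = n \<Longrightarrow>
      circuit_eval (Circuit (map ConstGate b @ gs) [out]) xs = [f ((!) (xs @ b))]"
proof -
  obtain gs where gs: "length gs \<le> s" "wf_gates (n + l) gs"
    "\<exists>j < n + l + length gs. \<forall>xs. length xs = n + l \<longrightarrow> wires xs gs ! j = f ((!) xs)"
    using computes_gates[OF assms(1)] by auto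
  then obtain out where out: "out < n + l + length gs"
    "\<And>xs. length xs = n + l \<Longrightarrow> wires xs gs ! out = f ((!) xs)" by auto
  \<comment> \<open>Constant gates pad the program so that together with the \<open>l\<close> gates
    for \<open>b\<close> the size is exactly \<open>S\<close>.\<close>
  define gs' where "gs' = gs @ replicate (S - l - length gs) (ConstGate False)"
  have len: "length gs' = S - l" "length gs \<le> S - l"
    using gs assms(2) by (simp_all add: gs'_def)
  have wf': "j < n + (l + i)" if "i < S - l" "j \<in> gate_args (gs' ! i)" for i j
    using that gs(2) unfolding gs'_def wf_gates_def
    by (cases "i < length gs") (auto simp: nth_append add.assoc split: if_splits)
  show thesis
  proof (rule that[of gs' out])
    fix b :: "bool list"
    assume b: "length b = l"
    have "j < n + i" if "i < S" "j \<in> gate_args ((map ConstGate b @ gs') ! i)" for i j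
    proof (cases "i < l")
      case True
      then show ?thesis using that b by (simp add: nth_append)
    next
      case False
      then show ?thesis using that b wf'[of "i - l" j] by (simp add: nth_append)
    qed
    then show "wf_circuit n 1 (Circuit (map ConstGate b @ gs') [out])"
      using b len out assms(2) by (auto simp: wf_circuit_def)
    show "circuit_size (Circuit (map ConstGate b @ gs') [out]) = S"
      using b len assms(2) by (simp add: circuit_size_def)
    fix xs :: "bool list"
    assume "length xs = n"
    \<comment> \<open>The constant gates turn the wire list into \<open>xs @ b\<close>, on which
      \<open>gs\<close> runs as on \<open>n + l\<close> genuine inputs.\<close>
    then have "wires xs (map ConstGate b @ gs') ! out = f ((!) (xs @ b))"
      using b out by (simp add: gs'_def wires_append wires_ConstGate wires_nth length_wires)
    then show "circuit_eval (Circuit (map ConstGate b @ gs') [out]) xs = [f ((!) (xs @ b))]"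
      by (simp add: circuit_eval_def Let_def flip: wires_def)
  qed
qed


section \<open>Simulation of Turing machines by circuits\<close>

definition config_at :: "tm \<Rightarrow> nat \<Rightarrow> bool list \<Rightarrow> config" where
  "config_at M t w = (step M ^^ t) (init_config w)"

abbreviation "state_at M t w \<equiv> fst (config_at M t w)"
abbreviation "head_at M t w \<equiv> fst (snd (config_at M t w))"
abbreviation "tape_at M t w \<equiv> snd (snd (config_at M t w))"

text \<open>The freezing of state 1 becomes part of the table, so that every step, halted or not, is
  one lookup.\<close>

definition transition :: "tm \<Rightarrow> nat \<Rightarrow> nat \<Rightarrow> nat \<times> nat \<times> move" where
  "transition M q a = (if q = 1 then (1, a, Stay) else delta M q a)"

lemma config_at_0: "config_at M 0 w = (0, 0, tape_of w)"
  by (simp add: config_at_def init_config_def)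

lemma config_at_Suc:
  "config_at M (Suc t) w =
    (case transition M (state_at M t w) (tape_at M t w (head_at M t w)) of (q, a, d) \<Rightarrow>
      (q, move_head d (head_at M t w), (tape_at M t w)(head_at M t w := a)))"
  by (auto simp: config_at_def step_def transition_def split: prod.splits)

text \<open>The head moves by at most one cell per step, so the first \<open>N\<close> cells are
  enough for a simulation up to any time \<open>t < N\<close>.\<close>

lemma config_at_bounds:
  assumes "wf_tm M"
  shows "state_at M t w < states M" "head_at M t w \<le> t" "tape_at M t w p < symbols M"
proof -
  have "state_at M t w < states M \<and> head_at M t w \<le> t \<and> (\<forall>p. tape_at M t w p < symbols M)"
  proof (induction t)
    case 0
    then show ?case using assms by (auto simp: config_at_0 wf_tm_def tape_of_def bit_symbol_def)
  next
    case (Suc t)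
    obtain q a d where tr: "transition M (state_at M t w) (tape_at M t w (head_at M t w)) = (q, a, d)"
      by (metis prod_cases3)
    have "case delta M (state_at M t w) (tape_at M t w (head_at M t w)) of
        (q', a', d) \<Rightarrow> q' < states M \<and> a' < symbols M"
      using assms Suc by (simp add: wf_tm_def)
    with tr Suc assms have "q < states M \<and> a < symbols M"
      by (cases "state_at M t w = 1") (auto simp: transition_def wf_tm_def)
    moreover have "move_head d (head_at M t w) \<le> Suc t"
      using Suc by (cases d) auto
    ultimately show ?case using Suc by (simp add: config_at_Suc tr)
  qed
  then show "state_at M t w < states M" "head_at M t w \<le> t" "tape_at M t w p < symbols M"
    by auto
qed

lemma config_at_halted:
  assumes "state_at M t w = 1" and "t \<le> t'"
  shows "config_at M t' w = config_at M t w"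
  using assms(2)
proof (induction t' rule: dec_induct)
  case (step t')
  then show ?case using assms(1)
    by (cases "config_at M t w") (simp add: config_at_Suc transition_def)
qed simp

text \<open>\<open>returns\<close> leaves the halting time open. A halted configuration never
  changes, so the one at that time and the one at time \<open>T\<close> agree.\<close>

lemma output_after_halting:
  assumes "halts_within M w T" and "returns M w out" and "i \<le> length out"
  shows "tape_at M T w i = tape_of out i"
proof -
  obtain n h t where n: "config_at M n w = (1, h, t)" "\<forall>i \<le> length out. t i = tape_of out i"
    using assms(2) by (auto simp: returns_def config_at_def)
  then have "state_at M n w = 1" by simp
  moreover have "state_at M T w = 1"
    using assms(1) by (simp add: halts_within_def config_at_def)
  ultimately have "config_at M T w = config_at M n w"
    by (metis config_at_halted nat_le_linear)
  with n assms(3) show ?thesis by simp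
qed

text \<open>One-hot encoding of the configuration at time \<open>t\<close> on the first
  \<open>N\<close> cells. The machine input \<open>w v\<close> is itself a function of the valuation
  \<open>v\<close>.\<close>

definition config_tests :: "tm \<Rightarrow> nat \<Rightarrow> ('v \<Rightarrow> bool list) \<Rightarrow> nat \<Rightarrow> ('v \<Rightarrow> bool) set" where
  "config_tests M N w t =
    (\<lambda>q v. state_at M t (w v) = q) ` {..<states M} \<union>
    ((\<lambda>p v. head_at M t (w v) = p) ` {..<N} \<union>
    (\<lambda>(p, a) v. tape_at M t (w v) p = a) ` ({..<N} \<times> {..<symbols M}))"

lemma config_tests_memb:
  "q < states M \<Longrightarrow> (\<lambda>v. state_at M t (w v) = q) \<in> config_tests M N w t"
  "p < N \<Longrightarrow> (\<lambda>v. head_at M t (w v) = p) \<in> config_tests M N w t"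
  "p < N \<Longrightarrow> a < symbols M \<Longrightarrow> (\<lambda>v. tape_at M t (w v) p = a) \<in> config_tests M N w t"
  unfolding config_tests_def
  by (rule UnI1, rule image_eqI[where x = q], simp, simp,
      rule UnI2, rule UnI1, rule image_eqI[where x = p], simp, simp,
      rule UnI2, rule UnI2, rule image_eqI[where x = "(p, a)"], simp, simp)

lemma computes_config_tests:
  assumes "\<And>q. q < states M \<Longrightarrow> computes B s {\<lambda>v. state_at M t (w v) = q}"
    and "\<And>p. p < N \<Longrightarrow> computes B s {\<lambda>v. head_at M t (w v) = p}"
    and "\<And>p a. p < N \<Longrightarrow> a < symbols M \<Longrightarrow> computes B s {\<lambda>v. tape_at M t (w v) p = a}"
  shows "computes B ((states M + N + N * symbols M) * s) (config_tests M N w t)"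
proof -
  have "computes B (card {..<states M} * s + (card {..<N} * s + card ({..<N} \<times> {..<symbols M}) * s))
    (config_tests M N w t)"
    unfolding config_tests_def
    by (intro computes_Un computes_image) (use assms in auto)
  then show ?thesis by (simp add: algebra_simps)
qed

lemma computes_config_tests_0:
  assumes "\<And>v. length (w v) = m" and "\<And>i. i < m \<Longrightarrow> (\<lambda>v. w v ! i) \<in> B"
  shows "computes B (states M + N + N * symbols M) (config_tests M N w 0)"
proof -
  have bit: "computes B 1 {\<lambda>v. tape_of (w v) p = a}" for p a
  proof (cases "p < m")
    case True
    then have mem: "(\<lambda>v. w v ! p) \<in> B" using assms(2) by simp
    \<comment> \<open>Symbols 2 and 1 stand for the bits \<open>True\<close> and
      \<open>False\<close>; no other symbol occurs on the input cells at time 0.\<close>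
    consider "a = 2" | "a = 1" | "a \<noteq> 1" "a \<noteq> 2" by auto
    then show ?thesis
    proof cases
      case 1
      then have "(\<lambda>v. tape_of (w v) p = a) = (\<lambda>v. w v ! p)"
        using True assms(1) by (simp add: tape_of_def bit_symbol_def fun_eq_iff)
      then show ?thesis using mem by (simp add: computes_refl)
    next
      case 2
      then have "(\<lambda>v. tape_of (w v) p = a) = (\<lambda>v. \<not> w v ! p)"
        using True assms(1) by (simp add: tape_of_def bit_symbol_def fun_eq_iff)
      moreover have "computes B (Suc 0) {\<lambda>v. \<not> w v ! p}"
        using mem by (intro computes_neg computes_refl) simp
      ultimately show ?thesis by simp
    next
      case 3
      then have "(\<lambda>v. tape_of (w v) p = a) = (\<lambda>v. False)"
        using True assms(1) by (simp add: tape_of_def bit_symbol_def fun_eq_iff)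
      then show ?thesis using computes_const[of B False] by simp
    qed
  next
    case False
    then have "(\<lambda>v. tape_of (w v) p = a) = (\<lambda>v. 0 = a)"
      using assms(1) by (simp add: tape_of_def fun_eq_iff)
    then show ?thesis using computes_const[of B "0 = a"] by simp
  qed
  have "computes B ((states M + N + N * symbols M) * 1) (config_tests M N w 0)"
    by (rule computes_config_tests; unfold config_at_0 fst_conv snd_conv; rule computes_const bit)
  then show ?thesis by simp
qed

text \<open>Exactly one triple of state, head position and scanned symbol holds at each
  \<open>v\<close>. A new test asks whether it is among the triples that the table sends to the
  tested value; a cell away from the head keeps its symbol.\<close>

lemma computes_config_tests_Suc:
  assumes M: "wf_tm M" and N: "t < N"
  shows "computes (config_tests M N w t)
    ((states M + N + N * symbols M) * (3 * (states M * N * symbols M) + 4))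
    (config_tests M N w (Suc t))"
proof -
  let ?B = "config_tests M N w t" and ?I = "{..<states M} \<times> {..<N} \<times> {..<symbols M}"
  let ?K = "3 * (states M * N * symbols M) + 4"
  define f where "f i v \<longleftrightarrow> state_at M t (w v) = fst i \<and> head_at M t (w v) = fst (snd i) \<and>
    tape_at M t (w v) (fst (snd i)) = snd (snd i)" for i v
  have f: "computes ?B 2 {f i}" if "i \<in> ?I" for i
  proof -
    have "computes ?B (Suc (0 + Suc (0 + 0))) {f i}"
      unfolding f_def
      by (intro computes_conj computes_refl) (use that in \<open>auto simp: config_tests_memb\<close>)
    then show ?thesis by (simp add: numeral_2_eq_2)
  qed
  \<comment> \<open>A triple costs two conjunctions and a disjunction; the extra 1 is the constant
    that starts the chain.\<close>
  have ex: "computes ?B s {\<lambda>v. \<exists>i\<in>J. f i v}"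
    if J: "J \<subseteq> ?I" and s: "3 * (states M * N * symbols M) + 1 \<le> s" for J s
  proof -
    have "card J \<le> card ?I" using J by (intro card_mono) auto
    also have "card ?I = states M * N * symbols M" by simp
    finally have le: "card J * Suc 2 + 1 \<le> s" using s by simp
    have "computes ?B (card J * Suc 2 + 1) {\<lambda>v. \<exists>i\<in>J. f i v}"
    proof (rule computes_Bex)
      show "finite J" using J by (rule finite_subset) simp
      show "computes ?B 2 {f i}" if "i \<in> J" for i using that J f by blast
    qed
    then show ?thesis by (rule computes_mono[OF _ le]) simp
  qed
  let ?i = "\<lambda>v. (state_at M t (w v), head_at M t (w v), tape_at M t (w v) (head_at M t (w v)))"
  have in_I: "?i v \<in> ?I" for v
    using config_at_bounds[OF M, of t "w v"] N by (auto intro: le_less_trans)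
  have ex_iff: "(\<exists>i\<in>{i \<in> ?I. P i}. f i v) \<longleftrightarrow> P (?i v)" for P v
    using in_I[of v] by (auto simp: f_def)
  show ?thesis
  proof (rule computes_config_tests)
    fix q assume "q < states M"
    have *: "(\<lambda>v. state_at M (Suc t) (w v) = q) =
        (\<lambda>v. \<exists>i\<in>{i \<in> ?I. fst (transition M (fst i) (snd (snd i))) = q}. f i v)"
      unfolding ex_iff by (intro ext) (auto simp: config_at_Suc split_beta)
    show "computes ?B ?K {\<lambda>v. state_at M (Suc t) (w v) = q}"
      unfolding * by (rule ex) auto

  next
    fix p assume "p < N"
    have *: "(\<lambda>v. head_at M (Suc t) (w v) = p) =
        (\<lambda>v. \<exists>i\<in>{i \<in> ?I. move_head (snd (snd (transition M (fst i) (snd (snd i))))) (fst (snd i)) = p}. f i v)"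
      unfolding ex_iff by (intro ext) (auto simp: config_at_Suc split_beta)
    show "computes ?B ?K {\<lambda>v. head_at M (Suc t) (w v) = p}"
      unfolding * by (rule ex) auto

  next
    fix p b assume p: "p < N" and b: "b < symbols M"
    let ?J = "{i \<in> ?I. fst (snd i) = p \<and> fst (snd (transition M (fst i) (snd (snd i)))) = b}"
    \<comment> \<open>Cell \<open>p\<close> holds \<open>b\<close> either because the head just
      wrote it there or because the head was elsewhere and \<open>b\<close> was there before. The
      second case costs three more gates, whence the 4 in \<open>?K\<close>.\<close>
    have *: "(\<lambda>v. tape_at M (Suc t) (w v) p = b) =
        (\<lambda>v. (\<exists>i\<in>?J. f i v) \<or> (\<not> head_at M t (w v) = p \<and> tape_at M t (w v) p = b))"
      unfolding ex_iff by (intro ext) (auto simp: config_at_Suc split_beta)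
    have "computes ?B (Suc ((3 * (states M * N * symbols M) + 1) + Suc (Suc 0 + 0)))
        {\<lambda>v. (\<exists>i\<in>?J. f i v) \<or> (\<not> head_at M t (w v) = p \<and> tape_at M t (w v) p = b)}"
      by (intro computes_disj computes_conj computes_neg ex computes_refl)
        (use p b in \<open>auto simp: config_tests_memb\<close>)
    then show "computes ?B ?K {\<lambda>v. tape_at M (Suc t) (w v) p = b}"
      unfolding * by (rule computes_mono) simp_all
  qed
qed

text \<open>The layers for times 0 to \<open>T\<close> are composed, and
  \<open>computes_trans\<close> adds their costs.\<close>

lemma computes_config_tests_steps:
  assumes M: "wf_tm M" and w: "\<And>v. length (w v) = m" "\<And>i. i < m \<Longrightarrow> (\<lambda>v. w v ! i) \<in> B"
    and T: "T < N"
  shows "computes B (21 * (states M * symbols M)\<^sup>2 * N ^ 3) (config_tests M N w T)"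
proof -
  let ?W = "states M + N + N * symbols M" and ?V = "states M * N * symbols M"
  have "computes B (?W + t * (?W * (3 * ?V + 4))) (config_tests M N w t)" if "t < N" for t
    using that
  proof (induction t)
    case 0
    then show ?case using computes_config_tests_0[OF w] by simp
  next
    case (Suc t)
    then have "computes B (?W + t * (?W * (3 * ?V + 4))) (config_tests M N w t)" by simp
    moreover have "computes (config_tests M N w t) (?W * (3 * ?V + 4)) (config_tests M N w (Suc t))"
      using Suc.prems by (intro computes_config_tests_Suc[OF M]) simp
    ultimately have "computes B (?W + t * (?W * (3 * ?V + 4)) + ?W * (3 * ?V + 4))
        (config_tests M N w (Suc t))"
      by (rule computes_trans)
    then show ?case by (simp add: algebra_simps)
  qed
  from this[OF T] have "computes B (?W + T * (?W * (3 * ?V + 4))) (config_tests M N w T)" .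
  moreover have "?W + T * (?W * (3 * ?V + 4)) \<le> 21 * (states M * symbols M)\<^sup>2 * N ^ 3"
  proof -
    have pos: "1 \<le> states M" "1 \<le> symbols M" "1 \<le> N"
      using M T by (auto simp: wf_tm_def)
    then have "1 \<le> ?V" by simp
    have "states M * 1 * 1 \<le> ?V" "1 * N * 1 \<le> ?V" "1 * N * symbols M \<le> ?V"
      by (intro mult_le_mono; use pos in simp)+
    then have W: "?W \<le> 3 * ?V" by linarith
    \<comment> \<open>The total follows from \<open>?W \<le> 3 * ?V\<close>,
      \<open>3 * ?V + 4 \<le> 7 * ?V\<close> and \<open>Suc T \<le> N\<close>.\<close>
    have "?W + T * (?W * (3 * ?V + 4)) \<le> ?W * (3 * ?V + 4) + T * (?W * (3 * ?V + 4))"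
      by simp
    also have "\<dots> = Suc T * (?W * (3 * ?V + 4))" by simp
    also have "\<dots> \<le> N * ((3 * ?V) * (7 * ?V))"
      using \<open>1 \<le> ?V\<close> W T by (intro mult_le_mono) simp_all
    also have "\<dots> = 21 * (states M * symbols M)\<^sup>2 * N ^ 3"
      by (simp add: power2_eq_square power3_eq_cube)
    finally show ?thesis .
  qed
  ultimately show ?thesis by (rule computes_mono) simp
qed

text \<open>The variables are laid out as \<open>k\<close> bits of \<open>x\<close>, then
  \<open>l\<close> bits of \<open>y\<close>, then \<open>l\<close> bits of \<open>b\<close>. One
  polynomial in \<open>l\<close> serves all \<open>k\<close> and \<open>j\<close>, since
  \<open>x\<close> does not enter the tested condition.\<close>

lemma poly_time_preimage_circuit:
  assumes h: "poly_time_computable h" and len: "\<And>w. length (h w) = length w"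
  obtains p :: "nat poly" where
    "\<And>k l j. j < l \<Longrightarrow> computes (inputs (k + l + l)) (poly p l)
      {\<lambda>v. h (map v [k..<k + l]) = map v [k + l..<k + l + l] \<and> v (k + j)}"
proof -
  obtain M p where M: "wf_tm M"
    and run: "\<And>w. halts_within M w (poly p (length w))" "\<And>w. returns M w (h w)"
    using h by (auto simp: poly_time_computable_def)
  define C where "C = 21 * (states M * symbols M)\<^sup>2"
  \<comment> \<open>The gate count as a polynomial: \<open>C * ?N ^ 3\<close> for the simulation of
    \<open>h\<close>, and \<open>6 * l + 2\<close> for comparing with \<open>b\<close> and testing
    bit \<open>j\<close>.\<close>
  define q :: "nat poly" where "q = smult C ((p + [:1, 1:]) ^ 3) + [:2, 6:]"
  have "computes (inputs (k + l + l)) (poly q l)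
      {\<lambda>v. h (map v [k..<k + l]) = map v [k + l..<k + l + l] \<and> v (k + j)}" if j: "j < l" for k l j
  proof -
    let ?y = "\<lambda>v :: nat \<Rightarrow> bool. map v [k..<k + l]" and ?B = "inputs (k + l + l)"
    \<comment> \<open>\<open>?N\<close> exceeds the running time, as the simulation demands, and
      also covers the \<open>l\<close> output cells.\<close>
    let ?T = "poly p l" and ?N = "poly p l + l + 1"
    let ?G = "config_tests M ?N ?y ?T"
    have G: "computes ?B (C * ?N ^ 3) ?G"
      unfolding C_def by (rule computes_config_tests_steps[OF M, where m = l]) (auto simp: in_inputs)
    have bit: "h (?y v) ! i \<longleftrightarrow> tape_at M ?T (?y v) i = 2" if "i < l" for v i
      using output_after_halting[OF run, of i "?y v"] that len[of "?y v"]
      by (simp add: tape_of_def bit_symbol_def)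
    have "h (?y v) = map v [k + l..<k + l + l] \<longleftrightarrow>
        (\<forall>i\<in>{..<l}. (tape_at M ?T (?y v) i = 2) = v (k + l + i))" for v
      using len[of "?y v"] by (auto simp: list_eq_iff_nth_eq bit)
    then have *: "(h (?y v) = map v [k + l..<k + l + l] \<and> v (k + j)) =
        ((\<forall>i\<in>{..<l}. (tape_at M ?T (?y v) i = 2) = v (k + l + i)) \<and> v (k + j))" for v
      by simp
    have "3 \<le> symbols M" using M by (simp add: wf_tm_def)
    then have "computes (?G \<union> ?B) (2 * 0 + 2 * 0 + 5)
        {\<lambda>v. (tape_at M ?T (?y v) i = 2) = v (k + l + i)}" if "i < l" for i
      using that by (intro computes_iff computes_refl) (auto intro: config_tests_memb in_inputs)
    then have "computes (?G \<union> ?B) (card {..<l} * Suc 5 + 1)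
        {\<lambda>v. \<forall>i\<in>{..<l}. (tape_at M ?T (?y v) i = 2) = v (k + l + i)}"
      by (intro computes_Ball) simp_all
    moreover have "computes (?G \<union> ?B) 0 {\<lambda>v. v (k + j)}"
      using j by (intro computes_refl) (auto intro: in_inputs)
    ultimately have "computes (?G \<union> ?B) (Suc (card {..<l} * Suc 5 + 1 + 0))
        {\<lambda>v. h (?y v) = map v [k + l..<k + l + l] \<and> v (k + j)}"
      unfolding * by (rule computes_conj)
    moreover have "computes ?B (C * ?N ^ 3 + 0) (?G \<union> ?B)"
      by (intro computes_Un G computes_refl subset_refl)
    ultimately have "computes ?B (C * ?N ^ 3 + 0 + Suc (card {..<l} * Suc 5 + 1 + 0))
        {\<lambda>v. h (?y v) = map v [k + l..<k + l + l] \<and> v (k + j)}"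
      by (rule computes_trans[rotated])
    then show ?thesis by (simp add: q_def algebra_simps)
  qed
  then show thesis by (rule that)
qed


section \<open>Reading off an answer of the search task\<close>

text \<open>The length does not vary with \<open>v\<close>; this is the form in which the simulation
  takes its input word.\<close>

definition bit_template :: "('v \<Rightarrow> bool) set \<Rightarrow> ('v \<Rightarrow> bool list) \<Rightarrow> bool" where
  "bit_template B w \<longleftrightarrow> (\<exists>m. \<forall>v. length (w v) = m \<and> (\<forall>i<m. (\<lambda>v. w v ! i) \<in> B))"

lemma bit_template_append:
  assumes "bit_template B w" and "bit_template B w'"
  shows "bit_template B (\<lambda>v. w v @ w' v)"
proof -
  obtain m m' where m: "\<And>v. length (w v) = m" "\<And>i. i < m \<Longrightarrow> (\<lambda>v. w v ! i) \<in> B"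
    and m': "\<And>v. length (w' v) = m'" "\<And>i. i < m' \<Longrightarrow> (\<lambda>v. w' v ! i) \<in> B"
    using assms by (auto simp: bit_template_def)
  have "(\<lambda>v. (w v @ w' v) ! i) \<in> B" if "i < m + m'" for i
    using that m m' by (cases "i < m") (simp_all add: nth_append)
  then show ?thesis
    unfolding bit_template_def by (intro exI[of _ "m + m'"]) (simp add: m m')
qed

lemma bit_template_const: "range (\<lambda>b v. b) \<subseteq> B \<Longrightarrow> bit_template B (\<lambda>_. xs)"
  unfolding bit_template_def by (intro exI[of _ "length xs"]) auto

lemma bit_template_single: "f \<in> B \<Longrightarrow> bit_template B (\<lambda>v. [f v])"
  unfolding bit_template_def by (intro exI[of _ 1]) simp

text \<open>A constant gate is coded by a fixed prefix followed by its bit, so the hardwired bits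
  sit at fixed positions of the input word and all the rest is constant.\<close>

lemma bit_template_hardwired:
  assumes "inputs l \<union> range (\<lambda>b v. b) \<subseteq> B"
  shows "bit_template B
    (\<lambda>v. cert_input k (Circuit (map ConstGate (map v [0..<l]) @ gs) out))"
proof -
  have const: "range (\<lambda>b v. b) \<subseteq> B" and inp: "\<And>i. i < l \<Longrightarrow> (\<lambda>v. v i) \<in> B"
    using assms in_inputs by auto
  have gates: "bit_template B (\<lambda>v. concat (map (\<lambda>i. [True, False, False] @ [v i]) [0..<n]))"
    if "n \<le> l" for n
    using that
  proof (induction n)
    case 0
    then show ?case using bit_template_const[OF const] by simp
  next
    case (Suc n)
    then have "bit_template B (\<lambda>v. concat (map (\<lambda>i. [True, False, False] @ [v i]) [0..<n]) @
        ([True, False, False] @ [v n]))"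
      by (intro bit_template_append bit_template_const[OF const] bit_template_single inp) auto
    then show ?case by simp
  qed
  have "bit_template B (\<lambda>v. (replicate k True @ [False]) @
      (concat (map (\<lambda>i. [True, False, False] @ [v i]) [0..<l]) @
       (list_code gate_code gs @ list_code nat_code out)))"
    by (intro bit_template_append bit_template_const[OF const] gates) auto
  then show ?thesis
    by (simp add: cert_input_def circuit_code_def list_code_def comp_def)
qed

lemma computes_inputs_consts: "computes (inputs l) 2 (inputs l \<union> range (\<lambda>b v. b))"
proof -
  have "computes (inputs l) (0 + (1 + 1)) (inputs l \<union> ({\<lambda>v. True} \<union> {\<lambda>v. False}))"
    by (intro computes_Un computes_const computes_refl subset_refl)
  then show ?thesis
    by (rule computes_mono) (auto simp: UNIV_bool)
qed

text \<open>Satisfiability does not depend on \<open>x\<close>, so a valid answer is falsifiable if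
  \<open>P v\<close> holds and a tautology otherwise. The circuit runs \<open>M\<close> and looks
  the answer up in the table of all tautologies of length \<open>k\<close>.\<close>

lemma computes_satisfiability:
  assumes M: "wf_tm M"
    and input: "bit_template B (\<lambda>v. cert_input k (D v))"
    and halts: "\<And>v. halts_within M (cert_input k (D v)) T"
    and solves: "\<And>v. \<exists>w. returns M (cert_input k (D v)) w \<and> cert_valid c k (D v) w"
    and indep: "\<And>v x. length x = k \<Longrightarrow> satisfiable_in_y (k ^ c) (D v) x \<longleftrightarrow> P v"
  shows "computes B (21 * (states M * symbols M)\<^sup>2 * (T + k + 1) ^ 3 + (2 ^ k * (k + 2) + 2)) {P}"
proof -
  \<comment> \<open>The table is hardwired: no gates are spent on deciding whether a word codes a
    tautology.\<close>
  define Taut where "Taut = {w \<in> bitstrings k. \<exists>p. encodes w p \<and> tautology p}"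
  define I where "I v = cert_input k (D v)" for v
  let ?G = "config_tests M (T + k + 1) I T"
  obtain m where "\<And>v. length (I v) = m" "\<And>i. i < m \<Longrightarrow> (\<lambda>v. I v ! i) \<in> B"
    using input by (auto simp: bit_template_def I_def)
  then have G: "computes B (21 * (states M * symbols M)\<^sup>2 * (T + k + 1) ^ 3) ?G"
    by (intro computes_config_tests_steps[OF M]) auto
  have fin: "finite (bitstrings k)" and card: "card (bitstrings k) = 2 ^ k"
    using finite_lists_length_eq[of "UNIV :: bool set" k] card_lists_length_eq[of "UNIV :: bool set" k]
    by (simp_all add: bitstrings_def card_UNIV_bool)
  \<comment> \<open>The first \<open>k\<close> cells match exactly one word of length
    \<open>k\<close>, the answer; by \<open>encodes_unique\<close> it cannot code both a tautology
    and a falsifiable formula.\<close>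
  have P: "P v \<longleftrightarrow> \<not> (\<exists>w\<in>Taut. \<forall>i\<in>{..<k}. tape_at M T (I v) i = bit_symbol (w ! i))" for v
  proof -
    obtain w where w: "returns M (I v) w" "cert_valid c k (D v) w"
      using solves by (auto simp: I_def)
    have len: "length w = k" using w by (auto simp: cert_valid_def bitstrings_def)
    have "tape_at M T (I v) i = bit_symbol (w ! i)" if "i < k" for i
      using output_after_halting[OF halts, folded I_def, OF w(1)] that len by (simp add: tape_of_def)
    moreover have "bit_symbol x = bit_symbol y \<longleftrightarrow> x = y" for x y
      by (simp add: bit_symbol_def)
    ultimately have "(\<forall>i\<in>{..<k}. tape_at M T (I v) i = bit_symbol (w' ! i)) \<longleftrightarrow> w' = w"
      if "w' \<in> Taut" for w'
      using that len by (auto simp: Taut_def bitstrings_def list_eq_iff_nth_eq)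
    then have "(\<exists>w\<in>Taut. \<forall>i\<in>{..<k}. tape_at M T (I v) i = bit_symbol (w ! i)) \<longleftrightarrow> w \<in> Taut"
      by auto
    moreover obtain p where p: "encodes w p" "falsifiable p \<and> P v \<or> tautology p \<and> \<not> P v"
      using w(2) indep[OF len] by (auto simp: cert_valid_def)
    moreover have "w \<in> Taut \<longleftrightarrow> tautology p"
      using p(1) len encodes_unique[of w] unfolding Taut_def bitstrings_def by blast
    moreover have "falsifiable p \<longleftrightarrow> \<not> tautology p"
      by (simp add: falsifiable_def tautology_def)
    ultimately show ?thesis by blast
  qed
  have "3 \<le> symbols M" using M by (simp add: wf_tm_def)
  then have "computes ?G 0 {\<lambda>v. tape_at M T (I v) i = bit_symbol (w ! i)}" if "i < k" for i w
    using that by (intro computes_refl) (auto intro!: config_tests_memb simp: bit_symbol_def)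
  then have "computes ?G (card {..<k} * Suc 0 + 1)
      {\<lambda>v. \<forall>i\<in>{..<k}. tape_at M T (I v) i = bit_symbol (w ! i)}" for w
    by (rule computes_Ball[OF finite_lessThan]) simp
  moreover have "finite Taut" using fin by (simp add: Taut_def)
  ultimately have "computes ?G (Suc (card Taut * Suc (card {..<k} * Suc 0 + 1) + 1))
      {\<lambda>v. \<not> (\<exists>w\<in>Taut. \<forall>i\<in>{..<k}. tape_at M T (I v) i = bit_symbol (w ! i))}"
    by (intro computes_neg[OF computes_Bex])
  then have "computes ?G (Suc (card Taut * Suc (card {..<k} * Suc 0 + 1) + 1)) {P}"
    unfolding P[symmetric] .
  moreover have "card Taut \<le> 2 ^ k"
    unfolding card[symmetric] by (intro card_mono fin) (auto simp: Taut_def)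
  then have "card Taut * (k + 2) \<le> 2 ^ k * (k + 2)"
    by (rule mult_le_mono1)
  then have "Suc (card Taut * Suc (card {..<k} * Suc 0 + 1) + 1) \<le> 2 ^ k * (k + 2) + 2"
    by simp
  ultimately have "computes ?G (2 ^ k * (k + 2) + 2) {P}"
    by (rule computes_mono) (rule subset_refl)
  with G show ?thesis by (rule computes_trans)
qed


section \<open>Inverting the permutation\<close>

lemma poly_le_power: "\<exists>d. \<forall>n\<ge>2. poly p n \<le> n ^ d" for p :: "nat poly"
proof (induction p)
  case (pCons a p)
  then obtain d where d: "\<And>n. n \<ge> 2 \<Longrightarrow> poly p n \<le> n ^ d" by auto
  \<comment> \<open>Both summands \<open>a\<close> and \<open>n * poly p n\<close> are at most
    \<open>n ^ (a + d + 1)\<close>; one more factor \<open>n \<ge> 2\<close> absorbs the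
    sum.\<close>
  have "poly (pCons a p) n \<le> n ^ (a + d + 2)" if n: "n \<ge> 2" for n
  proof -
    have "a \<le> 2 ^ a" by simp
    also have "\<dots> \<le> n ^ a" using n by (intro power_mono) auto
    also have "\<dots> \<le> n ^ (a + d + 1)" using n by (intro power_increasing) auto
    finally have 1: "a \<le> n ^ (a + d + 1)" .
    have "n * poly p n \<le> n * n ^ d" using d[OF n] by simp
    also have "\<dots> = n ^ (d + 1)" by simp
    also have "\<dots> \<le> n ^ (a + d + 1)" using n by (intro power_increasing) auto
    finally have "poly (pCons a p) n \<le> 2 * n ^ (a + d + 1)"
      using 1 unfolding poly_pCons by linarith
    also have "\<dots> \<le> n * n ^ (a + d + 1)" using n by (intro mult_right_mono) auto
    finally show ?thesis by simp
  qed
  then show ?case by blast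
qed auto

text \<open>In the exponent, \<open>k ^ c\<close> contributes \<open>c\<close> and the cube
  \<open>3 * a + 3\<close>; the coefficients add up to \<open>27 * C + 7\<close>, which fits into a
  further power of 2 because \<open>k \<ge> 1\<close>.\<close>

lemma inverter_size_bound:
  fixes k :: nat
  assumes "k \<ge> 1"
  shows "k ^ c * (2 + (C * (2 ^ (a * k) + k + 1) ^ 3 + (2 ^ k * (k + 2) + 2)))
    \<le> 2 ^ ((c + 27 * C + 3 * a + 10) * k)"
proof -
  have k: "k \<le> 2 ^ k" "(1::nat) \<le> 2 ^ k" by simp_all
  have e: "(2::nat) ^ i \<le> 2 ^ j" if "i \<le> j" for i j :: nat
    using that by (intro power_increasing) auto
  have 1: "k ^ c \<le> 2 ^ (c * k)"
    using power_mono[OF k(1), of c] by (simp add: power_mult[symmetric] mult.commute)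
  have "k \<le> 2 ^ ((a + 1) * k)" by (rule order_trans[OF k(1) e]) simp
  then have "2 ^ (a * k) + k + 1 \<le> 2 ^ ((a + 1) * k) + 2 ^ ((a + 1) * k) + (2::nat) ^ ((a + 1) * k)"
    by (intro add_mono e) simp_all
  then have "(2 ^ (a * k) + k + 1) ^ 3 \<le> (3 * 2 ^ ((a + 1) * k)) ^ 3"
    by (intro power_mono) auto
  also have "\<dots> = 27 * 2 ^ ((3 * a + 3) * k)"
    by (simp add: power_mult_distrib power_mult[symmetric] algebra_simps)
  finally have 2: "C * (2 ^ (a * k) + k + 1) ^ 3 \<le> 27 * C * 2 ^ ((3 * a + 3) * k)"
    by (simp add: mult.assoc mult.left_commute)
  have "2 ^ k * (k + 2) \<le> 2 ^ k * (3 * 2 ^ k)" by (rule mult_le_mono2) (use k in linarith)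
  also have "\<dots> = 3 * 2 ^ (2 * k)" by (simp add: power_add[symmetric] mult_2)
  also have "\<dots> \<le> 3 * 2 ^ ((3 * a + 3) * k)" using e[of "2 * k" "(3 * a + 3) * k"] by simp
  finally have 3: "2 ^ k * (k + 2) \<le> 3 * 2 ^ ((3 * a + 3) * k)" .
  have "2 + (C * (2 ^ (a * k) + k + 1) ^ 3 + (2 ^ k * (k + 2) + 2)) \<le>
      27 * C * 2 ^ ((3 * a + 3) * k) + 3 * 2 ^ ((3 * a + 3) * k) + 4 * 2 ^ ((3 * a + 3) * k)"
    using 2 3 one_le_power[of "2::nat" "(3 * a + 3) * k"] by linarith
  also have "\<dots> = (27 * C + 7) * 2 ^ ((3 * a + 3) * k)" by (simp add: algebra_simps)
  also have "\<dots> \<le> 2 ^ ((27 * C + 7) * k) * 2 ^ ((3 * a + 3) * k)"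
  proof (intro mult_right_mono)
    have "27 * C + 7 \<le> 2 ^ (27 * C + 7)" by (rule less_imp_le) simp
    also have "\<dots> \<le> 2 ^ ((27 * C + 7) * k)" using assms by (intro e) simp
    finally show "27 * C + 7 \<le> 2 ^ ((27 * C + 7) * k)" .
  qed simp
  finally have "k ^ c * (2 + (C * (2 ^ (a * k) + k + 1) ^ 3 + (2 ^ k * (k + 2) + 2)))
      \<le> 2 ^ (c * k) * (2 ^ ((27 * C + 7) * k) * 2 ^ ((3 * a + 3) * k))"
    by (rule mult_mono[OF 1]) simp_all
  also have "\<dots> = 2 ^ ((c + 27 * C + 3 * a + 10) * k)"
    by (simp add: power_add[symmetric] algebra_simps)
  finally show ?thesis .
qed

text \<open>\<open>D\<close> succeeds with probability 1, whereas the permitted probability is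
  strictly below 1 for \<open>l \<ge> 1\<close>.\<close>

lemma no_correct_inverter:
  assumes h: "bij_betw h (bitstrings l) (bitstrings l)" and l: "l \<ge> 1"
    and ow: "one_way_at h (\<lambda>l. 2 powr (- (real l powr \<gamma>))) t l"
    and D: "wf_circuit l l D" "real (circuit_size D) \<le> t l"
    and inv: "\<And>u. length u = l \<Longrightarrow> circuit_eval D (h u) = u"
  shows False
proof -
  have ne: "bitstrings l \<noteq> {}" "finite (bitstrings l)"
    using finite_lists_length_eq[of "UNIV :: bool set" l] Ex_list_of_length[of l]
    by (auto simp: bitstrings_def)
  have "measure_pmf.prob (pmf_of_set (bitstrings l)) {v. circuit_eval D (h v) = v} = 1"
    using inv ne by (subst measure_pmf.prob_eq_1) (auto simp: AE_measure_pmf_iff bitstrings_def)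
  then have "1 \<le> 2 powr (- (real l powr \<gamma>))"
    using ow D unfolding one_way_at_def by fastforce
  moreover have "2 powr (- (real l powr \<gamma>)) < 2 powr 0"
    using l by (intro powr_less_mono) auto
  ultimately show False by simp
qed

text \<open>One circuit for each bit of the preimage, placed side by side. The hypothesis
  \<open>size\<close> leaves room to pad the checking circuit to the size that the task
  prescribes.\<close>

lemma cert_solver_inverts:
  assumes bij: "\<And>l. bij_betw h (bitstrings l) (bitstrings l)"
    and p: "\<And>k l j. j < l \<Longrightarrow> computes (inputs (k + l + l)) (poly p l)
      {\<lambda>v. h (map v [k..<k + l]) = map v [k + l..<k + l + l] \<and> v (k + j)}"
    and size: "k ^ c + poly p (k ^ c) \<le> k ^ c\<^sup>2"
    and M: "wf_tm M" "solves_cert c M k"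
    and halts: "\<And>D. cert_circuit c k D \<Longrightarrow> halts_within M (cert_input k D) T"
  obtains C where "wf_circuit (k ^ c) (k ^ c) C"
    "circuit_size C \<le> k ^ c *
      (2 + (21 * (states M * symbols M)\<^sup>2 * (T + k + 1) ^ 3 + (2 ^ k * (k + 2) + 2)))"
    "\<And>u. length u = k ^ c \<Longrightarrow> circuit_eval C (h u) = u"
proof -
  define l where "l = k ^ c"
  \<comment> \<open>\<open>P j\<close> reads \<open>b\<close> from the valuation. As
    \<open>h\<close> is injective on words of length \<open>l\<close>, for \<open>b = h u\<close> it
    is bit \<open>j\<close> of \<open>u\<close>.\<close>
  define P where "P j v \<longleftrightarrow> (\<exists>y\<in>bitstrings l. h y = map v [0..<l] \<and> y ! j)" for j and v :: "nat \<Rightarrow> bool"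
  let ?K = "21 * (states M * symbols M)\<^sup>2 * (T + k + 1) ^ 3 + (2 ^ k * (k + 2) + 2)"
  have "computes (inputs l) (2 + ?K) {P j}" if j: "j < l" for j
  proof -
    \<comment> \<open>\<open>gs\<close> and \<open>out\<close> are fixed before \<open>b\<close>, so
      that \<open>b\<close> enters the input of \<open>M\<close> only through the constant
      gates.\<close>
    obtain gs out where D:
      "\<And>b. length b = l \<Longrightarrow> wf_circuit (k + l) 1 (Circuit (map ConstGate b @ gs) [out])"
      "\<And>b. length b = l \<Longrightarrow> circuit_size (Circuit (map ConstGate b @ gs) [out]) = k ^ c\<^sup>2"
      "\<And>b xs. length b = l \<Longrightarrow> length xs = k + l \<Longrightarrow>
        circuit_eval (Circuit (map ConstGate b @ gs) [out]) xs =
          [h (map ((!) (xs @ b)) [k..<k + l]) = map ((!) (xs @ b)) [k + l..<k + l + l] \<and>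
           (xs @ b) ! (k + j)]"
      using computes_hardwired_circuit[OF p[OF j] size[folded l_def]] by metis
    define D where "D v = Circuit (map ConstGate (map v [0..<l]) @ gs) [out]" for v :: "nat \<Rightarrow> bool"
    have cert: "cert_circuit c k (D v)" for v
      using D(1,2)[of "map v [0..<l]"] by (simp add: cert_circuit_def D_def l_def)
    have eval: "circuit_eval (D v) (x @ y) = [h y = map v [0..<l] \<and> y ! j]"
      if "length x = k" "length y = l" for v x y
    proof -
      have "map ((!) ((x @ y) @ map v [0..<l])) [k..<k + l] = y"
        "map ((!) ((x @ y) @ map v [0..<l])) [k + l..<k + l + l] = map v [0..<l]"
        "((x @ y) @ map v [0..<l]) ! (k + j) = y ! j"
        using that j by (auto simp: list_eq_iff_nth_eq nth_append)
      then show ?thesis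
        unfolding D_def using that by (subst D(3)) simp_all
    qed
    have "computes (inputs l \<union> range (\<lambda>b v. b)) ?K {P j}"
    proof (rule computes_satisfiability[OF M(1), where D = D])
      show "bit_template (inputs l \<union> range (\<lambda>b v. b)) (\<lambda>v. cert_input k (D v))"
        unfolding D_def by (intro bit_template_hardwired subset_refl)
      show "halts_within M (cert_input k (D v)) T" for v
        using cert by (rule halts)
      show "\<exists>w. returns M (cert_input k (D v)) w \<and> cert_valid c k (D v) w" for v
        using M(2) cert by (simp add: solves_cert_def)
      show "satisfiable_in_y (k ^ c) (D v) x \<longleftrightarrow> P j v" if "length x = k" for v x
        unfolding satisfiable_in_y_def P_def l_def[symmetric]
        by (rule bex_cong) (simp_all add: eval that bitstrings_def)
    qed
    \<comment> \<open>The 2 additional gates supply the constants \<open>True\<close> and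
      \<open>False\<close> for the fixed part of the machine input.\<close>
    with computes_inputs_consts show ?thesis by (rule computes_trans)
  qed
  then have "computes (inputs l) (card {..<l} * (2 + ?K)) (P ` {..<l})"
    by (intro computes_image) auto
  then obtain C where C: "wf_circuit l l C" "circuit_size C \<le> l * (2 + ?K)"
    "\<And>xs. length xs = l \<Longrightarrow> circuit_eval C xs = map (\<lambda>i. P i ((!) xs)) [0..<l]"
    using computes_circuit[of l "card {..<l} * (2 + ?K)" P l] by auto
  have "circuit_eval C (h u) = u" if u: "length u = l" for u
  proof -
    have len: "length (h u) = l"
      using u bij_betwE[OF bij[of l]] by (simp add: bitstrings_def)
    then have "map ((!) (h u)) [0..<l] = h u" by (metis map_nth)
    moreover have "h y = h u \<longleftrightarrow> y = u" if "y \<in> bitstrings l" for y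
      using bij_betw_imp_inj_on[OF bij[of l]] that u by (auto simp: inj_on_def bitstrings_def)
    ultimately have "P i ((!) (h u)) \<longleftrightarrow> u ! i" for i
      using u unfolding P_def by (auto simp: bitstrings_def)
    then show ?thesis using C(3)[OF len] u by (simp add: list_eq_iff_nth_eq)
  qed
  with C show thesis by (intro that) (auto simp: l_def)
qed

theorem corollary4p2:
  assumes "\<exists>h. exp_hard_one_way_permutation h"
  shows "\<exists>c::nat. c \<ge> 1 \<and>
    \<not> (\<exists>M. wf_tm M \<and> cert_exp_time c M \<and> (\<forall>k \<ge> 1. solves_cert c M k))"
proof -
  obtain h \<gamma> where h: "poly_time_computable h" and bij: "\<And>l. bij_betw h (bitstrings l) (bitstrings l)"
    and \<gamma>: "\<gamma> > 0"
    and ev: "\<forall>\<^sub>F l in sequentially.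
      one_way_at h (\<lambda>l. 2 powr (- (real l powr \<gamma>))) (\<lambda>l. 2 powr (real l powr \<gamma>)) l"
    using assms by (auto simp: exp_hard_one_way_permutation_def)
  obtain L where L: "\<And>l. l \<ge> L \<Longrightarrow>
      one_way_at h (\<lambda>l. 2 powr (- (real l powr \<gamma>))) (\<lambda>l. 2 powr (real l powr \<gamma>)) l"
    using ev by (auto simp: eventually_sequentially)
  have len: "length (h w) = length w" for w
    using bij_betwE[OF bij[of "length w"]] by (simp add: bitstrings_def)
  obtain p where p: "\<And>k l j. j < l \<Longrightarrow> computes (inputs (k + l + l)) (poly p l)
      {\<lambda>v. h (map v [k..<k + l]) = map v [k + l..<k + l + l] \<and> v (k + j)}"
    using poly_time_preimage_circuit[OF h len] by blast
  \<comment> \<open>The summand \<open>[:0, 1:]\<close> accounts for the constant gates that carry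
    \<open>b\<close>.\<close>
  obtain d where d: "\<And>n. n \<ge> 2 \<Longrightarrow> poly ([:0, 1:] + p) n \<le> n ^ d"
    using poly_le_power by blast
  \<comment> \<open>\<open>d \<le> c\<close> keeps the checking circuit within size
    \<open>k ^ c\<^sup>2\<close>, and \<open>c \<ge> 2 / \<gamma>\<close> gives
    \<open>k ^ 2 \<le> (k ^ c) powr \<gamma>\<close>.\<close>
  define c where "c = max 1 (max d (nat \<lceil>2 / \<gamma>\<rceil>))"
  have c: "1 \<le> c" "d \<le> c" "2 / \<gamma> \<le> real c"
    unfolding c_def by linarith+
  have c\<gamma>: "2 \<le> real c * \<gamma>" using c(3) \<gamma> by (simp add: field_simps)
  have False if M: "wf_tm M" "cert_exp_time c M" "\<forall>k \<ge> 1. solves_cert c M k" for M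
  proof -
    obtain a where a: "\<And>k D. k \<ge> 1 \<Longrightarrow> cert_circuit c k D \<Longrightarrow>
        halts_within M (cert_input k D) (2 ^ (a * k))"
      using M(2) by (auto simp: cert_exp_time_def)
    define A where "A = c + 27 * (21 * (states M * symbols M)\<^sup>2) + 3 * a + 10"
    \<comment> \<open>A single length refutes \<open>M\<close>: \<open>k \<ge> L\<close> makes
      \<open>h\<close> hard at length \<open>k ^ c\<close>, \<open>k \<ge> A\<close> yields
      \<open>A * k \<le> k ^ 2\<close>, and \<open>k \<ge> 2\<close> makes the bound with
      \<open>d\<close> applicable.\<close>
    define k where "k = L + A + 2"
    have k: "k \<ge> 2" "k \<ge> L" "k \<ge> A" by (simp_all add: k_def)
    have kc: "k \<le> k ^ c" using k c(1) self_le_power[of k c] by simp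
    have "k ^ c + poly p (k ^ c) \<le> (k ^ c) ^ d" using d[of "k ^ c"] kc k by simp
    also have "\<dots> \<le> (k ^ c) ^ c" using kc k c(2) by (intro power_increasing) auto
    also have "\<dots> = k ^ c\<^sup>2" by (simp add: power_mult[symmetric] power2_eq_square)
    finally have size: "k ^ c + poly p (k ^ c) \<le> k ^ c\<^sup>2" .
    have sol: "solves_cert c M k" using M(3) k by simp
    have halts: "halts_within M (cert_input k D) (2 ^ (a * k))" if "cert_circuit c k D" for D
      using that k by (intro a) simp_all
    obtain C where C: "wf_circuit (k ^ c) (k ^ c) C"
      "circuit_size C \<le> k ^ c *
        (2 + (21 * (states M * symbols M)\<^sup>2 * (2 ^ (a * k) + k + 1) ^ 3 + (2 ^ k * (k + 2) + 2)))"
      "\<And>u. length u = k ^ c \<Longrightarrow> circuit_eval C (h u) = u"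
      by (rule cert_solver_inverts[where T = "2 ^ (a * k)", OF bij _ size M(1) sol])
        (erule p, erule halts, rule that)
    have "circuit_size C \<le> 2 ^ (A * k)"
      using C(2) inverter_size_bound[of k c "21 * (states M * symbols M)\<^sup>2" a] k
      unfolding A_def by linarith
    then have "real (circuit_size C) \<le> 2 ^ (A * k)"
      by (metis of_nat_le_iff of_nat_numeral of_nat_power)
    also have "\<dots> = 2 powr (real (A * k))" by (rule powr_realpow[symmetric]) simp
    also have "\<dots> \<le> 2 powr (real (k ^ c) powr \<gamma>)"
    proof (intro powr_mono)
      have "real (A * k) \<le> real k ^ 2" using k by (simp add: power2_eq_square)
      also have "\<dots> = real k powr 2" using k by (simp add: powr_numeral)
      also have "\<dots> \<le> real k powr (real c * \<gamma>)" using c\<gamma> k by (intro powr_mono) auto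
      also have "\<dots> = real (k ^ c) powr \<gamma>" using k by (simp add: powr_powr[symmetric] powr_realpow)
      finally show "real (A * k) \<le> real (k ^ c) powr \<gamma>" .
    qed simp
    finally have small: "real (circuit_size C) \<le> 2 powr (real (k ^ c) powr \<gamma>)" .
    show False
      by (rule no_correct_inverter[OF bij _ L C(1) small C(3)]) (use kc k in auto)
  qed
  with c(1) show ?thesis by blast
qed

end
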